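(* Suppose that $\{A_n\}_{n \in \mathbb{N}}$ is a sequence of sets in the plane $\mathbb{R}^2$ such that $A_{n+1} \subseteq A_n$ for all $n$, and that for every $n$ the set $A_{n+1}$ can be written as a union $$A_{n+1} = \bigcup_{i=1}^N \left(r_i A_n + \beta_i\right)$$ for some fixed (independent of $n$) finite collection of contraction ratios $r_i > 0$ and translation vectors $\beta_i \in \mathbb{R}^2$, $1 \le i \le N$, where $\sum_{i=1}^N r_i = 1$. Then for each angle $\theta$, the sequence $\{|\pi_\theta A_n|\}_{n \in \mathbb{N}}$ is convex, i.e. $|\pi_\theta A_n| \le \frac{1}{2}\left(|\pi_\theta A_{n-1}| + |\pi_\theta A_{n+1}|\right)$ whenever $n-1, n, n+1 \in \mathbb{N}$.
   Context: For an angle $\theta$, $\pi_\theta$ denotes orthogonal projection of $\mathbb{R}^2$ onto the line $L_\theta$ through the origin making angle $\theta$ with the positive $x$-axis. For a subset $X$ of $L_\theta$, $|X|$ denotes its one-dimensional Lebesgue measure (length) within $L_\theta$; use of this notation presupposes that the projections $\pi_\theta A_n$ are Lebesgue measurable in $L_\theta$. For $r > 0$ and $\beta \in \mathbb{R}^2$, $rA + \beta = \{ra + \beta : a \in A\}$. *)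

theory Defs
  imports "HOL-Analysis.Analysis"
begin

definition dir :: "real \<Rightarrow> real ^ 2" where
  "dir \<theta> = vector [cos \<theta>, sin \<theta>]"

definition line_at :: "real \<Rightarrow> (real ^ 2) set" where
  "line_at \<theta> = range (\<lambda>t. t *\<^sub>R dir \<theta>)"

definition proj_at :: "real \<Rightarrow> real ^ 2 \<Rightarrow> real ^ 2" where
  "proj_at \<theta> x = (x \<bullet> dir \<theta>) *\<^sub>R dir \<theta>"

(* One-dimensional Lebesgue measure within the line: since dir \<theta> is a unit vector,
   t \<mapsto> t dir \<theta> is an isometry from the reals onto the line, and the (completed) Lebesgue
   measure is transported along it. The sets of this measure are the Lebesgue measurable
   subsets of the line; emeasure allows infinite length. *)
definition line_lebesgue :: "real \<Rightarrow> (real ^ 2) measure" where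
  "line_lebesgue \<theta> = embed_measure lebesgue (\<lambda>t. t *\<^sub>R dir \<theta>)"

lemma norm_dir: "norm (dir \<theta>) = 1"
  by (simp add: dir_def norm_vec_def L2_set_def UNIV_2)

lemma inner_dir_self: "dir \<theta> \<bullet> dir \<theta> = 1"
  by (simp add: norm_dir dot_square_norm)

lemma space_line_lebesgue: "space (line_lebesgue \<theta>) = line_at \<theta>"
  by (simp add: line_lebesgue_def line_at_def space_embed_measure)

lemma inj_dir: "inj (\<lambda>t. t *\<^sub>R dir \<theta>)"
  using norm_dir[of \<theta>] by (auto intro!: injI)

lemma sets_line_lebesgue:
  "sets (line_lebesgue \<theta>) = {(\<lambda>t. t *\<^sub>R dir \<theta>) ` S |S. S \<in> sets lebesgue}"
  unfolding line_lebesgue_def by (rule sets_embed_measure[OF inj_dir])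

lemma emeasure_line_lebesgue:
  assumes "X \<in> sets (line_lebesgue \<theta>)"
  shows "emeasure (line_lebesgue \<theta>) X = emeasure lebesgue {t. t *\<^sub>R dir \<theta> \<in> X}"
  using assms emeasure_embed_measure[OF inj_dir, of X lebesgue \<theta>]
  unfolding line_lebesgue_def by (simp add: vimage_def)

lemma proj_at_in_line: "proj_at \<theta> x \<in> line_at \<theta>"
  unfolding proj_at_def line_at_def by (rule rangeI)

lemma proj_at_orthogonal:
  assumes "y \<in> line_at \<theta>"
  shows "orthogonal (x - proj_at \<theta> x) y"
  using assms
  by (auto simp: line_at_def proj_at_def orthogonal_def inner_diff_left inner_dir_self)

end

theory Submission
  imports Defs
begin

text \<open>
  Identify the line with the reals by t \<mapsto> t dir \<theta>. The coordinates of the projections form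
  decreasing sets B n, and since the projection is linear they inherit the self-similarity:
  B (n + 1) is the union of the similar copies r i B n + b i. The idea is to follow the part of
  the length that is lost at each step. A point of B n outside B (n + 1) lies in some copy
  r i B (n - 1) + b i, but not in the corresponding copy of B n; hence it lies in
  r i (B (n - 1) - B n) + b i. By subadditivity and because the ratios add up to 1, the loss
  |B n - B (n + 1)| is at most |B (n - 1) - B n| (lemma \<open>affine_copies_emeasure_le\<close>). A sequence
  whose successive decrements decrease is convex (lemma \<open>emeasure_convex_of_decreasing_loss\<close>).
\<close>

lemma affine_image_sets_lebesgue:
  fixes S :: "'a::euclidean_space set"
  assumes "S \<in> sets lebesgue"
  shows "(\<lambda>x. c *\<^sub>R x + d) ` S \<in> sets lebesgue"
proof (rule differentiable_image_in_sets_lebesgue[OF assms])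
  show "(\<lambda>x. c *\<^sub>R x + d) differentiable_on S"
    unfolding differentiable_on_def differentiable_def
    by (intro ballI exI) (rule derivative_intros)+
qed simp

text \<open>
  Overlaps between the copies can only decrease the measure of the union, so a family of
  affine maps of the real line whose slopes add up to 1 does not increase length.
\<close>

lemma affine_copies_emeasure_le:
  fixes S :: "real set" and r b :: "'i \<Rightarrow> real"
  assumes "finite I" "S \<in> sets lebesgue"
    and pos: "\<And>i. i \<in> I \<Longrightarrow> r i \<ge> 0" and sum: "(\<Sum>i\<in>I. r i) = 1"
  shows "emeasure lebesgue (\<Union>i\<in>I. (\<lambda>x. r i * x + b i) ` S) \<le> emeasure lebesgue S"
proof -
  have "emeasure lebesgue (\<Union>i\<in>I. (\<lambda>x. r i * x + b i) ` S)
      \<le> (\<Sum>i\<in>I. emeasure lebesgue ((\<lambda>x. r i * x + b i) ` S))"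
    using assms(1) affine_image_sets_lebesgue[OF assms(2)]
    by (intro emeasure_subadditive_finite) auto
  also have "\<dots> = (\<Sum>i\<in>I. ennreal (r i) * emeasure lebesgue S)"
  proof (rule sum.cong)
    fix i assume "i \<in> I"
    then show "emeasure lebesgue ((\<lambda>x. r i * x + b i) ` S) = ennreal (r i) * emeasure lebesgue S"
      using emeasure_lebesgue_affine[of "r i" "b i" S] pos[of i] by simp
  qed simp
  also have "\<dots> = ennreal (\<Sum>i\<in>I. r i) * emeasure lebesgue S"
    using pos by (simp add: sum_distrib_right[symmetric] sum_ennreal)
  finally show ?thesis
    by (simp add: sum)
qed

text \<open>
  The bound on the losses is added to the measures of \<open>Y\<close> and \<open>Z\<close>, and no measures are
  subtracted; in this form sets of infinite measure need no separate treatment.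
\<close>

lemma emeasure_convex_of_decreasing_loss:
  assumes sets: "X \<in> sets M" "Y \<in> sets M" "Z \<in> sets M"
    and "Y \<subseteq> X" "Z \<subseteq> Y"
    and loss: "emeasure M (Y - Z) \<le> emeasure M (X - Y)"
  shows "emeasure M Y \<le> (1 / 2) * (emeasure M X + emeasure M Z)"
proof -
  have X: "emeasure M X = emeasure M Y + emeasure M (X - Y)"
    using emeasure_Un[of Y M X] assms by (simp add: Un_absorb1)
  have Y: "emeasure M Y = emeasure M Z + emeasure M (Y - Z)"
    using emeasure_Un[of Z M Y] assms by (simp add: Un_absorb1)
  have "2 * emeasure M Y = emeasure M Y + (emeasure M Z + emeasure M (Y - Z))"
    unfolding mult_2 using Y by (rule arg_cong)
  also have "\<dots> \<le> emeasure M Y + (emeasure M Z + emeasure M (X - Y))"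
    by (intro add_left_mono loss)
  also have "\<dots> = emeasure M X + emeasure M Z"
    unfolding X by (simp only: ac_simps)
  finally have "(1 / 2) * (2 * emeasure M Y) \<le> (1 / 2) * (emeasure M X + emeasure M Z)"
    by (rule mult_left_mono) simp
  moreover have "(1 / 2) * (2 * emeasure M Y) = emeasure M Y"
    unfolding mult.assoc[symmetric] ennreal_divide_times by simp
  ultimately show ?thesis
    by simp
qed

lemma line_coordinate_sets_lebesgue:
  assumes "X \<in> sets (line_lebesgue \<theta>)"
  shows "{t. t *\<^sub>R dir \<theta> \<in> X} \<in> sets lebesgue"
proof -
  obtain S where "S \<in> sets lebesgue" "X = (\<lambda>t. t *\<^sub>R dir \<theta>) ` S"
    using assms by (auto simp: sets_line_lebesgue)
  moreover from this have "{t. t *\<^sub>R dir \<theta> \<in> X} = S"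
    using inj_vimage_image_eq[OF inj_dir, of \<theta> S] by (simp add: vimage_def)
  ultimately show ?thesis
    by simp
qed

lemma line_coordinate_proj_at:
  "{t. t *\<^sub>R dir \<theta> \<in> proj_at \<theta> ` X} = (\<lambda>x. x \<bullet> dir \<theta>) ` X"
proof -
  have "dir \<theta> \<noteq> 0"
    using norm_dir[of \<theta>] by auto
  then show ?thesis
    by (auto simp: proj_at_def)
qed

theorem theorem3p1:
  fixes A :: "nat \<Rightarrow> (real ^ 2) set"
    and N :: nat
    and r :: "nat \<Rightarrow> real"
    and \<beta> :: "nat \<Rightarrow> real ^ 2"
    and \<theta> :: real
  assumes decreasing: "\<And>n. A (Suc n) \<subseteq> A n"
    and self_similar: "\<And>n. A (Suc n) = (\<Union>i\<in>{1..N}. (\<lambda>a. r i *\<^sub>R a + \<beta> i) ` A n)"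
    and ratios_pos: "\<And>i. i \<in> {1..N} \<Longrightarrow> r i > 0"
    and ratios_sum: "(\<Sum>i=1..N. r i) = 1"
    and measurable: "\<And>n. proj_at \<theta> ` A n \<in> sets (line_lebesgue \<theta>)"
  shows "\<forall>n\<ge>1. emeasure (line_lebesgue \<theta>) (proj_at \<theta> ` A n)
    \<le> (1 / 2) * (emeasure (line_lebesgue \<theta>) (proj_at \<theta> ` A (n - 1))
              + emeasure (line_lebesgue \<theta>) (proj_at \<theta> ` A (n + 1)))"
proof (intro allI impI)
  fix n :: nat assume "n \<ge> 1"
  then obtain m where n: "n = Suc m"
    by (cases n) auto
  define B where "B k = (\<lambda>x. x \<bullet> dir \<theta>) ` A k" for k
  define b where "b i = \<beta> i \<bullet> dir \<theta>" for i
  have B_sets: "B k \<in> sets lebesgue" for k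
    using line_coordinate_sets_lebesgue[OF measurable[of k]]
    by (simp add: B_def line_coordinate_proj_at)
  have B_emeasure: "emeasure (line_lebesgue \<theta>) (proj_at \<theta> ` A k) = emeasure lebesgue (B k)" for k
    using emeasure_line_lebesgue[OF measurable[of k]]
    by (simp add: B_def line_coordinate_proj_at)
  have B_decreasing: "B (Suc k) \<subseteq> B k" for k
    using decreasing[of k] by (auto simp: B_def)
  have B_similar: "B (Suc k) = (\<Union>i\<in>{1..N}. (\<lambda>x. r i * x + b i) ` B k)" for k
    unfolding B_def b_def self_similar[of k]
    by (simp add: image_UN image_image inner_add_left)
  have "B (Suc m) - B (Suc (Suc m)) \<subseteq> (\<Union>i\<in>{1..N}. (\<lambda>x. r i * x + b i) ` (B m - B (Suc m)))"
    unfolding B_similar[of "Suc m"] by (subst B_similar[of m]) blast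
  moreover have "(\<Union>i\<in>{1..N}. (\<lambda>x. r i * x + b i) ` (B m - B (Suc m))) \<in> sets lebesgue"
    using affine_image_sets_lebesgue[where 'a = real] B_sets by (intro sets.finite_UN) auto
  ultimately have "emeasure lebesgue (B (Suc m) - B (Suc (Suc m)))
      \<le> emeasure lebesgue (\<Union>i\<in>{1..N}. (\<lambda>x. r i * x + b i) ` (B m - B (Suc m)))"
    by (rule emeasure_mono)
  also have "\<dots> \<le> emeasure lebesgue (B m - B (Suc m))"
    using B_sets ratios_pos ratios_sum
    by (intro affine_copies_emeasure_le) (auto intro: less_imp_le)
  finally show "emeasure (line_lebesgue \<theta>) (proj_at \<theta> ` A n)
    \<le> (1 / 2) * (emeasure (line_lebesgue \<theta>) (proj_at \<theta> ` A (n - 1))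
              + emeasure (line_lebesgue \<theta>) (proj_at \<theta> ` A (n + 1)))"
    using emeasure_convex_of_decreasing_loss[OF B_sets B_sets B_sets B_decreasing B_decreasing]
    by (simp add: n B_emeasure)
qed

end
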